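(* Let $K$ be a field, $d\geq 1$ an integer, $S=K[x_i: i\in\mathbb{N}]$, and let $V\subset S_d$ be a monomial space. Let $V^c\subset S_d$ be the complementary monomial space of $V$. Then $V$ is block stable if and only if $V^c$ is an ideal of the $K$-algebra $\mathcal{M}(d)=(S_d,* )$.
   Context: $\mathbb{N}=\{0,1,2,\ldots\}$. $S=K[x_i:i\in\mathbb{N}]$ is the standard graded polynomial ring in countably many variables, and $S_d$ is its degree $d$ component. A monomial space $V\subset S$ is a $K$-vector subspace having a $K$-basis consisting of monomials. If $V\subset S_d$ is a monomial space, $V^c$ is the $K$-span of the monomials of $S_d$ not in $V$. The algebra $\mathcal{M}(d)$ is the $K$-vector space $S_d$ with the commutative associative multiplication $*$ defined on monomials by $$(x_{i_1}\cdots x_{i_d})*(x_{j_1}\cdots x_{j_d})=x_{i_1+j_1}x_{i_2+j_2}\cdots x_{i_d+j_d}\quad\text{for } i_1\leq\cdots\leq i_d,\ j_1\leq\cdots\leq j_d,$$ extended $K$-bilinearly; its unit is $x_0^d$. A monomial space $V\subset S$ is block stable if for any monomial $u=x_0^{a_0}\cdots x_e^{a_e}\in V$ and any $i=1,\ldots,e$ one has $$\frac{u}{x_i^{a_i}\cdots x_e^{a_e}}\cdot x_{i-1}^{a_i}\cdots x_{e-1}^{a_e}\in V.$$ *)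

theory Defs
  imports Complex_Main "HOL-Library.Multiset" "HOL-Library.Poly_Mapping"
    "HOL-Algebra.Ideal" "HOL-Algebra.Module"
begin

section \<open>The polynomial ring in countably many variables\<close>

text \<open>A polynomial maps exponent vectors (finitely supported functions from variable indices
  to exponents) to coefficients; the ring structure is the convolution product of
  \<^theory>\<open>HOL-Library.Poly_Mapping\<close>.\<close>

type_synonym 'k pol = "(nat \<Rightarrow>\<^sub>0 nat) \<Rightarrow>\<^sub>0 'k"

definition var :: "nat \<Rightarrow> 'k::field pol" where
  "var i = Poly_Mapping.single (Poly_Mapping.single i 1) 1"

definition monom :: "(nat \<Rightarrow>\<^sub>0 nat) \<Rightarrow> 'k::field pol" where
  "monom m = Poly_Mapping.single m 1"

definition monomials :: "'k::field pol set" where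
  "monomials = range monom"

definition exp_degree :: "(nat \<Rightarrow>\<^sub>0 nat) \<Rightarrow> nat" where
  "exp_degree m = (\<Sum>i\<in>Poly_Mapping.keys m. Poly_Mapping.lookup m i)"

definition hom_part :: "nat \<Rightarrow> 'k::field pol set" where
  "hom_part d = {p. \<forall>m\<in>Poly_Mapping.keys p. exp_degree m = d}"

definition scale :: "'k::field \<Rightarrow> 'k pol \<Rightarrow> 'k pol" where
  "scale c p = Poly_Mapping.map ((*) c) p"

lemma lookup_scale [simp]: "Poly_Mapping.lookup (scale c p) m = c * Poly_Mapping.lookup p m"
  by (simp add: scale_def Poly_Mapping.map.rep_eq when_def)

global_interpretation pol_space: vector_space "scale :: 'k::field \<Rightarrow> 'k pol \<Rightarrow> 'k pol"
  by unfold_locales (auto intro!: poly_mapping_eqI simp: lookup_add algebra_simps)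


section \<open>Monomial spaces and block stability\<close>

definition monomial_space :: "'k::field pol set \<Rightarrow> bool" where
  "monomial_space V \<longleftrightarrow> pol_space.subspace V \<and>
     (\<exists>B\<subseteq>monomials. pol_space.independent B \<and> pol_space.span B = V)"

definition compl_space :: "nat \<Rightarrow> 'k::field pol set \<Rightarrow> 'k pol set" where
  "compl_space d V = pol_space.span (monomials \<inter> hom_part d - V)"

text \<open>Every monomial has many representations as a product of powers of the variables with
  index at most \<open>e\<close>, since exponents may vanish. The quotient of such a product by its factors
  of index at least \<open>i\<close> is the product of its factors of index less than \<open>i\<close>.\<close>

definition block_stable :: "'k::field pol set \<Rightarrow> bool" where
  "block_stable V \<longleftrightarrow>
     (\<forall>(a :: nat \<Rightarrow> nat) e. (\<Prod>k\<in>{0..e}. var k ^ a k) \<in> V \<longrightarrow>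
       (\<forall>i\<in>{1..e}. (\<Prod>k\<in>{0..<i}. var k ^ a k) * (\<Prod>k\<in>{i..e}. var (k - 1) ^ a k) \<in> V))"


section \<open>The algebra on the homogeneous polynomials of degree \<open>d\<close>\<close>

text \<open>The weakly increasing list of the variable indices of a monomial, with multiplicity.\<close>

definition index_list :: "(nat \<Rightarrow>\<^sub>0 nat) \<Rightarrow> nat list" where
  "index_list m =
     concat (map (\<lambda>i. replicate (Poly_Mapping.lookup m i) i) (sorted_list_of_set (Poly_Mapping.keys m)))"

definition star :: "'k::field pol \<Rightarrow> 'k pol \<Rightarrow> 'k pol" where
  "star p q = (\<Sum>m\<in>Poly_Mapping.keys p. \<Sum>n\<in>Poly_Mapping.keys q.
     scale (Poly_Mapping.lookup p m * Poly_Mapping.lookup q n)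
       (prod_list (map2 (\<lambda>i j. var (i + j)) (index_list m) (index_list n))))"

definition M_alg :: "nat \<Rightarrow> ('k::field, 'k pol) module" where
  "M_alg d = \<lparr>carrier = hom_part d, mult = star, one = var 0 ^ d,
              zero = 0, add = (+), smult = scale\<rparr>"

lemma prod_list_var:
  "prod_list (map var is) = (monom (sum_list (map (\<lambda>i. Poly_Mapping.single i 1) is)) :: 'k::field pol)"
  by (induction "is") (simp_all add: var_def monom_def mult_single)

lemma lookup_sum_list_single:
  "Poly_Mapping.lookup (sum_list (map (\<lambda>i. Poly_Mapping.single i (1::nat)) is)) j = count_list is j"
  by (induction "is") (auto simp: lookup_add lookup_single when_def)

lemma sorted_concat_replicate:
  "sorted xs \<Longrightarrow> sorted (concat (map (\<lambda>i. replicate (f i) i) (xs :: nat list)))"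
  by (induction xs) (auto simp: sorted_append)

lemma count_list_concat_replicate:
  "distinct xs \<Longrightarrow>
     count_list (concat (map (\<lambda>i. replicate (f i) i) xs)) j = (if j \<in> set xs then f j else 0)"
proof (induction xs)
  case (Cons x xs)
  have "count_list (replicate n x) j = (if j = x then n else 0)" for n
    by (induction n) auto
  with Cons show ?case by auto
qed simp

lemma sorted_index_list: "sorted (index_list m)"
  by (simp add: index_list_def sorted_concat_replicate)

lemma count_index_list: "count_list (index_list m) j = Poly_Mapping.lookup m j"
  by (simp add: index_list_def count_list_concat_replicate in_keys_iff)

lemma prod_list_index_list: "prod_list (map var (index_list m)) = (monom m :: 'k::field pol)"
proof -
  have "sum_list (map (\<lambda>i. Poly_Mapping.single i 1) (index_list m)) = m"
    by (rule poly_mapping_eqI) (simp only: lookup_sum_list_single count_index_list)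
  then show ?thesis
    by (simp only: prod_list_var)
qed

lemma index_list_sum_list:
  assumes "sorted is"
  shows "index_list (sum_list (map (\<lambda>i. Poly_Mapping.single i 1) is)) = is"
proof -
  let ?m = "sum_list (map (\<lambda>i. Poly_Mapping.single i (1::nat)) is)"
  have "mset (index_list ?m) = mset is"
    by (rule multiset_eqI)
      (simp only: count_mset count_index_list lookup_sum_list_single)
  with assms sorted_index_list show ?thesis
    by (metis properties_for_sort)
qed

text \<open>\<^const>\<open>star\<close> is the bilinear extension of the defining formula on monomials.\<close>

lemma star_monomials:
  assumes "sorted is" "sorted js"
  shows "star (prod_list (map var is)) (prod_list (map var js)) =
    (prod_list (map2 (\<lambda>i j. var (i + j)) is js) :: 'k::field pol)"
  using assms by (simp add: star_def prod_list_var index_list_sum_list monom_def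
      del: One_nat_def)

end

theory Submission
  imports Defs
begin

text \<open>A monomial of degree \<open>d\<close> is the same thing as a weakly increasing list of \<open>d\<close> variable
  indices, and in this encoding \<open>*\<close> is the entrywise addition of lists. Let \<open>L\<close> be the set of
  the lists whose monomials lie in \<open>V\<close>. Since \<open>*\<close> is bilinear and commutative, \<open>V\<^sup>c\<close> is an ideal iff no
  list outside \<open>L\<close> is carried into \<open>L\<close> by adding a list, that is, iff \<open>is + us \<in> L\<close> implies
  \<open>is \<in> L\<close> (\<open>ideal_compl_space_iff\<close>). On the other side, block stability says that \<open>L\<close> is
  closed under lowering by one all entries that are at least a given threshold \<open>i \<ge> 1\<close>
  (\<open>block_stable_iff_lower\<close>).

  These two closure properties agree (\<open>lower_closed_iff_summand_closed\<close>), because lowering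
  amounts to subtracting a step list \<open>0\<dots>01\<dots>1\<close>. The entries of a weakly increasing list
  that reach a threshold form a final segment, so lowering removes a step list
  (\<open>lower_add_indicator\<close>). Conversely, adding a step list to \<open>is\<close> creates a gap
  between the entries before the step and those after it, so a suitable threshold separates
  them and lowering undoes the addition (\<open>ex_lower_add_indicator\<close>). Finally, every weakly
  increasing list is a sum of step lists, so an arbitrary summand can be removed one step at a time.\<close>

abbreviation list_monomial :: "nat list \<Rightarrow> 'k::field pol" where
  "list_monomial is \<equiv> prod_list (map var is)"

definition index_lists :: "nat \<Rightarrow> nat list set" where
  "index_lists d = {is. sorted is \<and> length is = d}"


section \<open>Monomials as weakly increasing index lists\<close>

lemma length_index_list: "length (index_list m) = exp_degree m"
  by (simp add: index_list_def exp_degree_def length_concat comp_def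
      sum_list_distinct_conv_sum_set)

lemma monomials_eq: "monomials = (list_monomial ` {is. sorted is} :: 'k::field pol set)"
proof
  show "monomials \<subseteq> (list_monomial ` {is. sorted is} :: 'k pol set)"
    unfolding monomials_def
    by (auto simp: prod_list_index_list[symmetric] sorted_index_list)
  show "list_monomial ` {is. sorted is} \<subseteq> (monomials :: 'k pol set)"
    by (auto simp: prod_list_var monomials_def)
qed

lemma list_monomial_cong_mset:
  "mset is = mset js \<Longrightarrow> list_monomial is = (list_monomial js :: 'k::field pol)"
  by (metis mset_map prod_mset_prod_list)

lemma list_monomial_in_hom_part:
  assumes "sorted is"
  shows "(list_monomial is :: 'k::field pol) \<in> hom_part d \<longleftrightarrow> length is = d"
  using length_index_list[of "sum_list (map (\<lambda>i. Poly_Mapping.single i 1) is)"]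
  by (simp add: prod_list_var monom_def hom_part_def index_list_sum_list assms del: One_nat_def)

lemma monomials_hom_part:
  "monomials \<inter> hom_part d = (list_monomial ` index_lists d :: 'k::field pol set)"
  by (auto simp: monomials_eq list_monomial_in_hom_part index_lists_def)

lemma poly_mapping_eq_sum_monom:
  "(p :: 'k::field pol) = (\<Sum>m\<in>Poly_Mapping.keys p. scale (Poly_Mapping.lookup p m) (monom m))"
  by (rule poly_mapping_eqI)
    (simp add: lookup_sum monom_def lookup_single when_def in_keys_iff if_distrib cong: if_cong)

lemma in_span_monomials:
  assumes "\<And>m. m \<in> Poly_Mapping.keys p \<Longrightarrow> monom m \<in> (B :: 'k::field pol set)"
  shows "p \<in> pol_space.span B"
  by (subst poly_mapping_eq_sum_monom)
    (intro pol_space.span_sum pol_space.span_scale pol_space.span_base assms)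

lemma span_monomials: "pol_space.span monomials = (UNIV :: 'k::field pol set)"
  by (auto intro!: in_span_monomials simp: monomials_def)

text \<open>A space of polynomials cut out by a condition on their monomials. Homogeneity is such a condition,
  and so is being supported on a given set of monomials, which is how a monomial is tested
  for membership in a span of monomials.\<close>

lemma subspace_keys:
  "pol_space.subspace {p :: 'k::field pol. \<forall>m\<in>Poly_Mapping.keys p. P m}"
  by (rule pol_space.subspaceI) (use keys_add in \<open>fastforce simp: in_keys_iff\<close>)+

lemma monomial_in_spanD:
  assumes "B \<subseteq> (monomials :: 'k::field pol set)" "u \<in> monomials" "u \<in> pol_space.span B"
  shows "u \<in> B"
proof -
  have "pol_space.span B \<subseteq> {p. \<forall>m\<in>Poly_Mapping.keys p. monom m \<in> B}"
    using assms(1)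
    by (intro pol_space.span_minimal subspace_keys) (auto simp: monomials_def monom_def)
  with assms(2,3) show ?thesis by (auto simp: monomials_def monom_def)
qed

lemma subspace_hom_part: "pol_space.subspace (hom_part d :: 'k::field pol set)"
  unfolding hom_part_def by (rule subspace_keys)

lemma span_hom_part:
  "pol_space.span (list_monomial ` index_lists d) = (hom_part d :: 'k::field pol set)"
proof
  show "pol_space.span (list_monomial ` index_lists d) \<subseteq> (hom_part d :: 'k pol set)"
    using monomials_hom_part subspace_hom_part by (intro pol_space.span_minimal) blast+
  show "(hom_part d :: 'k pol set) \<subseteq> pol_space.span (list_monomial ` index_lists d)"
  proof
    fix p :: "'k pol" assume "p \<in> hom_part d"
    then show "p \<in> pol_space.span (list_monomial ` index_lists d)"
      unfolding monomials_hom_part[symmetric]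
      by (intro in_span_monomials) (auto simp: monomials_def hom_part_def monom_def)
  qed
qed


section \<open>The ring structure\<close>

lemma list_monomial_map2:
  "prod_list (map2 (\<lambda>i j. var (i + j)) is js) = (list_monomial (map2 (+) is js) :: 'k::field pol)"
  by (rule arg_cong[where f = prod_list]) auto

lemma sorted_map2_add:
  fixes "is" js :: "nat list"
  assumes "sorted is" "sorted js"
  shows "sorted (map2 (+) is js)"
  using assms by (auto simp: sorted_iff_nth_mono intro!: add_mono)

lemma map2_add_in_index_lists:
  "is \<in> index_lists d \<Longrightarrow> js \<in> index_lists d \<Longrightarrow> map2 (+) is js \<in> index_lists d"
  by (simp add: index_lists_def sorted_map2_add)

lemma map2_add_assoc:
  "map2 (+) (map2 (+) is js) ks = map2 (+) is (map2 (+) js (ks :: nat list))"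
  by (rule nth_equalityI) auto

lemma star_list_monomial:
  assumes "sorted is" "sorted js"
  shows "star (list_monomial is) (list_monomial js) =
    (list_monomial (map2 (+) is js) :: 'k::field pol)"
  by (simp only: star_monomials assms list_monomial_map2)

text \<open>The sums in \<^const>\<open>star\<close> range over supports, which change under addition and scaling. Any finite
  supersets of the supports give the same result, so several products can be written with common
  index sets, and bilinearity becomes a termwise identity.\<close>

lemma star_superset:
  assumes "finite A" "finite B" "Poly_Mapping.keys p \<subseteq> A" "Poly_Mapping.keys q \<subseteq> B"
  shows "star p q = (\<Sum>m\<in>A. \<Sum>n\<in>B.
     scale (Poly_Mapping.lookup p m * Poly_Mapping.lookup q n)
       (list_monomial (map2 (+) (index_list m) (index_list n)) :: 'k::field pol))"
proof -
  let ?f = "\<lambda>m n. scale (Poly_Mapping.lookup p m * Poly_Mapping.lookup q n)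
       (list_monomial (map2 (+) (index_list m) (index_list n)) :: 'k::field pol)"
  have "star p q = (\<Sum>m\<in>Poly_Mapping.keys p. \<Sum>n\<in>Poly_Mapping.keys q. ?f m n)"
    by (simp only: star_def list_monomial_map2)
  also have "\<dots> = (\<Sum>m\<in>Poly_Mapping.keys p. \<Sum>n\<in>B. ?f m n)"
    using assms by (intro sum.cong sum.mono_neutral_left) (auto simp: in_keys_iff)
  also have "\<dots> = (\<Sum>m\<in>A. \<Sum>n\<in>B. ?f m n)"
    using assms by (intro sum.mono_neutral_left) (auto simp: in_keys_iff)
  finally show ?thesis .
qed

lemma map2_add_commute: "map2 (+) is js = map2 (+) js (is :: nat list)"
  by (rule nth_equalityI) auto

lemma star_commute: "star p q = star q (p :: 'k::field pol)"
  unfolding star_def list_monomial_map2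
  by (subst sum.swap, subst map2_add_commute) (simp add: mult.commute)

lemma star_add_left: "star (p + p') q = star p q + star p' (q :: 'k::field pol)"
proof -
  let ?A = "Poly_Mapping.keys p \<union> Poly_Mapping.keys p'"
  have A: "Poly_Mapping.keys (p + p') \<subseteq> ?A" by (rule keys_add)
  show ?thesis
    using A by (simp add: star_superset[of ?A "Poly_Mapping.keys q"] lookup_add
        distrib_right pol_space.scale_left_distrib sum.distrib)
qed

lemma star_scale_left: "star (scale c p) q = scale c (star p (q :: 'k::field pol))"
proof -
  have "Poly_Mapping.keys (scale c p) \<subseteq> Poly_Mapping.keys p" by (auto simp: in_keys_iff)
  then show ?thesis
    by (simp add: star_superset[of "Poly_Mapping.keys p" "Poly_Mapping.keys q"]
        pol_space.scale_sum_right mult.assoc)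
qed

lemma star_zero_left: "star 0 q = (0 :: 'k::field pol)"
  by (simp add: star_def)

lemma star_add_right: "star q (p + p') = star q p + star q (p' :: 'k::field pol)"
  by (simp only: star_commute[of q] star_add_left)

lemma star_scale_right: "star q (scale c p) = scale c (star q (p :: 'k::field pol))"
  by (simp only: star_commute[of q] star_scale_left)

lemma star_zero_right: "star q 0 = (0 :: 'k::field pol)"
  by (simp only: star_commute[of q] star_zero_left)

lemmas star_linear =
  star_zero_left star_zero_right star_add_left star_add_right star_scale_left star_scale_right

lemma subspace_star_right:
  assumes "pol_space.subspace W"
  shows "pol_space.subspace {q. star p q \<in> (W :: 'k::field pol set)}"
  using assms unfolding pol_space.subspace_def by (simp add: star_linear)

text \<open>Extends closure properties of the product from monomials to their linear span; it gives
  both closure of \<^term>\<open>hom_part d\<close> and the absorption property of an ideal spanned by monomials.\<close>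

lemma star_in_span:
  assumes "p \<in> pol_space.span A" "q \<in> pol_space.span B"
    and AB: "\<And>a b. a \<in> A \<Longrightarrow> b \<in> B \<Longrightarrow> star a b \<in> C"
  shows "star p q \<in> pol_space.span (C :: 'k::field pol set)"
proof -
  have "star q a \<in> pol_space.span C" if "a \<in> A" for a
    using assms(2)
  proof (subst star_commute, rule pol_space.span_induct)
    show "pol_space.subspace {q. star a q \<in> pol_space.span C}"
      by (rule subspace_star_right) (rule pol_space.subspace_span)
  qed (intro pol_space.span_base AB that)
  note star_A = this
  have "star q p \<in> pol_space.span C"
    using assms(1)
  proof (rule pol_space.span_induct)
    show "pol_space.subspace {p. star q p \<in> pol_space.span C}"
      by (rule subspace_star_right) (rule pol_space.subspace_span)
  qed (rule star_A)
  then show ?thesis by (simp only: star_commute)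
qed

text \<open>Both sides are linear in each of the three factors, so each factor in turn can be
  reduced to a monomial, where entrywise addition of lists is associative. Lists of
  different lengths do no harm: \<^const>\<open>zip\<close> truncates to the shortest in either bracketing.\<close>

lemma star_assoc: "star (star p q) r = star p (star q (r :: 'k::field pol))"
proof -
  have in_span: "u \<in> pol_space.span (list_monomial ` {is. sorted is})" for u :: "'k pol"
    using span_monomials unfolding monomials_eq by blast
  let ?M = "list_monomial ` {is. sorted is} :: 'k pol set"
  have 1: "star (star p q) r = star p (star q r)" if "p \<in> ?M" "q \<in> ?M" "r \<in> ?M" for p q r
    using that by (auto simp: star_list_monomial sorted_map2_add map2_add_assoc simp del: map_map)
  have 2: "star (star p q) r = star p (star q r)" if "p \<in> ?M" "q \<in> ?M" for p q
  proof (rule pol_space.span_induct[OF in_span[of r]])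
    show "pol_space.subspace {r. star (star p q) r = star p (star q r)}"
      unfolding pol_space.subspace_def by (simp add: star_linear)
  qed (rule 1[OF that])
  have 3: "star (star p q) r = star p (star q r)" if "p \<in> ?M" for p
  proof (rule pol_space.span_induct[OF in_span[of q]])
    show "pol_space.subspace {q. star (star p q) r = star p (star q r)}"
      unfolding pol_space.subspace_def by (simp add: star_linear)
  qed (rule 2[OF that])
  show ?thesis
  proof (rule pol_space.span_induct[OF in_span[of p]])
    show "pol_space.subspace {p. star (star p q) r = star p (star q r)}"
      unfolding pol_space.subspace_def by (simp add: star_linear)
  qed (rule 3)
qed

lemma star_in_hom_part:
  "p \<in> hom_part d \<Longrightarrow> q \<in> hom_part d \<Longrightarrow> star p q \<in> (hom_part d :: 'k::field pol set)"
  unfolding span_hom_part[symmetric]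
  by (rule star_in_span)
    (auto simp: index_lists_def star_list_monomial sorted_map2_add simp del: map_map)

lemma zeros_in_index_lists: "replicate d 0 \<in> index_lists d"
  by (simp add: index_lists_def)

lemma list_monomial_zeros: "list_monomial (replicate d 0) = (var 0 ^ d :: 'k::field pol)"
  by simp

lemma one_in_hom_part: "var 0 ^ d \<in> (hom_part d :: 'k::field pol set)"
  unfolding span_hom_part[symmetric] list_monomial_zeros[symmetric]
  by (intro pol_space.span_base imageI zeros_in_index_lists)

lemma star_one:
  assumes "p \<in> hom_part d"
  shows "star (var 0 ^ d) p = (p :: 'k::field pol)"
proof -
  have 1: "star (var 0 ^ d) u = u" if "u \<in> list_monomial ` index_lists d" for u :: "'k pol"
  proof -
    from that obtain "is" where u: "u = list_monomial is" and s: "sorted is" "length is = d"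
      by (auto simp: index_lists_def)
    have "map2 (+) (replicate d 0) is = is"
      using s(2) by (intro nth_equalityI) auto
    then show ?thesis
      unfolding u list_monomial_zeros[symmetric]
      by (subst star_list_monomial) (simp_all only: s sorted_replicate)
  qed
  from assms have "p \<in> pol_space.span (list_monomial ` index_lists d)"
    by (simp only: span_hom_part)
  then show ?thesis
  proof (rule pol_space.span_induct)
    show "pol_space.subspace {p :: 'k pol. star (var 0 ^ d) p = p}"
      unfolding pol_space.subspace_def by (simp add: star_linear)
  qed (rule 1)
qed

lemma star_one_right: "p \<in> hom_part d \<Longrightarrow> star p (var 0 ^ d) = (p :: 'k::field pol)"
  by (subst star_commute) (rule star_one)

lemma ring_M_alg: "ring (M_alg d :: ('k::field, 'k pol) module)"
proof (rule ringI)
  show "abelian_group (M_alg d :: ('k, 'k pol) module)"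
  proof (rule abelian_groupI)
    fix x :: "'k pol" assume "x \<in> carrier (M_alg d)"
    then have "- x \<in> carrier (M_alg d)"
      by (simp add: M_alg_def pol_space.subspace_neg[OF subspace_hom_part])
    moreover have "- x \<oplus>\<^bsub>M_alg d\<^esub> x = \<zero>\<^bsub>M_alg d\<^esub>"
      by (simp add: M_alg_def)
    ultimately show "\<exists>y\<in>carrier (M_alg d). y \<oplus>\<^bsub>M_alg d\<^esub> x = \<zero>\<^bsub>M_alg d\<^esub>" ..
  qed (simp_all add: M_alg_def add_ac pol_space.subspace_0[OF subspace_hom_part]
      pol_space.subspace_add[OF subspace_hom_part])
  show "monoid (M_alg d :: ('k, 'k pol) module)"
    by (rule monoidI)
      (simp_all add: M_alg_def star_in_hom_part one_in_hom_part star_assoc star_one star_one_right)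
qed (simp_all add: M_alg_def star_linear)

text \<open>A subspace already contains negatives and \<open>*\<close> is commutative, so absorbing products on one
  side is all that separates a subspace from an ideal.\<close>

lemma ideal_M_alg_iff:
  assumes "pol_space.subspace I" "I \<subseteq> (hom_part d :: 'k::field pol set)"
  shows "ideal I (M_alg d) \<longleftrightarrow> (\<forall>p\<in>I. \<forall>q\<in>hom_part d. star p q \<in> I)"
proof
  assume "ideal I (M_alg d)"
  from ideal.I_r_closed[OF this] show "\<forall>p\<in>I. \<forall>q\<in>hom_part d. star p q \<in> I"
    by (simp add: M_alg_def)
next
  assume closed: "\<forall>p\<in>I. \<forall>q\<in>hom_part d. star p q \<in> I"
  let ?R = "M_alg d :: ('k, 'k pol) module"
  interpret R: ring ?R by (rule ring_M_alg)
  show "ideal I ?R"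
  proof (rule idealI)
    show "subgroup I (add_monoid ?R)"
    proof (rule group.subgroupI[OF R.a_group])
      fix p assume p: "p \<in> I"
      then have "\<ominus>\<^bsub>?R\<^esub> p = - p"
        using assms pol_space.subspace_neg[OF assms(1)]
        by (intro R.minus_equality) (auto simp: M_alg_def)
      then show "inv\<^bsub>add_monoid ?R\<^esub> p \<in> I"
        using p pol_space.subspace_neg[OF assms(1)] by (simp add: a_inv_def)
    qed (use assms pol_space.subspace_0[OF assms(1)] pol_space.subspace_add[OF assms(1)] in
        \<open>auto simp: M_alg_def\<close>)
    fix p q assume "p \<in> I" "q \<in> carrier ?R"
    then have "star p q \<in> I" using closed by (simp add: M_alg_def)
    then show "p \<otimes>\<^bsub>?R\<^esub> q \<in> I" "q \<otimes>\<^bsub>?R\<^esub> p \<in> I"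
      by (simp_all add: M_alg_def star_commute)
  qed (rule ring_M_alg)
qed


section \<open>Block stability on index lists\<close>

text \<open>The effect on a single index of a block move \<open>x\<^sub>k \<mapsto> x\<^sub>k\<^sub>-\<^sub>1\<close> for all \<open>k \<ge> i\<close>.\<close>

definition lower :: "nat \<Rightarrow> nat \<Rightarrow> nat" where
  "lower i j = (if i \<le> j then j - 1 else j)"

lemma prod_list_eq_prod_count:
  fixes f :: "nat \<Rightarrow> 'a::comm_monoid_mult"
  assumes "finite A" "set xs \<subseteq> A"
  shows "prod_list (map f xs) = (\<Prod>k\<in>A. f k ^ count_list xs k)"
  using assms(2)
proof (induction xs)
  case (Cons x xs)
  have "(\<Prod>k\<in>A. f k ^ count_list (x # xs) k) =
      (\<Prod>k\<in>A. (if k = x then f k else 1) * f k ^ count_list xs k)"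
    by (intro prod.cong) auto
  also have "\<dots> = f x * (\<Prod>k\<in>A. f k ^ count_list xs k)"
    using Cons.prems assms(1) by (simp add: prod.distrib prod.delta)
  finally show ?case using Cons by simp
qed simp

text \<open>Passes from exponents to index lists: the exponent of \<open>x\<^sub>k\<close> is the number of occurrences of \<open>k\<close>
  in the list. The upper index \<open>e\<close> in the definition of block stability is only a bound for the
  variables that occur, and can be taken as large as the threshold requires.\<close>

lemma block_stable_iff_lower:
  "block_stable (V :: 'k::field pol set) \<longleftrightarrow>
     (\<forall>is i. i \<ge> 1 \<longrightarrow> list_monomial is \<in> V \<longrightarrow> list_monomial (map (lower i) is) \<in> V)"
proof -
  have lowered: "list_monomial (map (lower i) is) =
      (\<Prod>k\<in>{0..<i}. var k ^ count_list is k) *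
      (\<Prod>k\<in>{i..e}. var (k - 1) ^ count_list is k :: 'k pol)"
    if "set is \<subseteq> {0..e}" "i \<le> e" for "is" i e
  proof -
    have "list_monomial (map (lower i) is) =
        (\<Prod>k\<in>{0..e}. (var (lower i k) :: 'k pol) ^ count_list is k)"
      using prod_list_eq_prod_count[OF _ that(1), of "\<lambda>k. var (lower i k) :: 'k pol"]
      by (simp add: comp_def)
    also have "{0..e} = {0..<i} \<union> {i..e}" using that(2) by auto
    also have "(\<Prod>k\<in>\<dots>. (var (lower i k) :: 'k pol) ^ count_list is k) =
        (\<Prod>k\<in>{0..<i}. var (lower i k) ^ count_list is k) *
        (\<Prod>k\<in>{i..e}. var (lower i k) ^ count_list is k)"
      by (rule prod.union_disjoint) auto
    also have "(\<Prod>k\<in>{0..<i}. (var (lower i k) :: 'k pol) ^ count_list is k) =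
        (\<Prod>k\<in>{0..<i}. var k ^ count_list is k)"
      by (rule prod.cong) (simp_all add: lower_def)
    also have "(\<Prod>k\<in>{i..e}. (var (lower i k) :: 'k pol) ^ count_list is k) =
        (\<Prod>k\<in>{i..e}. var (k - 1) ^ count_list is k)"
      by (rule prod.cong) (simp_all add: lower_def)
    finally show ?thesis .
  qed
  show ?thesis
  proof (intro iffI allI impI)
    fix "is" :: "nat list" and i :: nat
    assume stable: "block_stable V" and i: "i \<ge> 1" and V: "list_monomial is \<in> V"
    \<comment> \<open>Large enough to bound both the entries of the list and the threshold.\<close>
    define e where "e = i + sum_list is"
    have set_is: "set is \<subseteq> {0..e}"
      using member_le_sum_list by (force simp: e_def)
    have "(\<Prod>k\<in>{0..e}. var k ^ count_list is k) \<in> V"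
      using V prod_list_eq_prod_count[OF _ set_is, of "var :: nat \<Rightarrow> 'k pol"] by simp
    moreover have "i \<in> {1..e}" using i by (simp add: e_def)
    ultimately show "list_monomial (map (lower i) is) \<in> V"
      using stable unfolding block_stable_def
      by (subst lowered[OF set_is]) auto
  next
    assume stable: "\<forall>is i. i \<ge> 1 \<longrightarrow> list_monomial is \<in> V \<longrightarrow>
      list_monomial (map (lower i) is) \<in> V"
    show "block_stable V"
      unfolding block_stable_def
    proof (intro allI impI ballI)
      fix a :: "nat \<Rightarrow> nat" and e i
      assume V: "(\<Prod>k\<in>{0..e}. var k ^ a k) \<in> V" and i: "i \<in> {1..e}"
      define "is" where "is = concat (map (\<lambda>k. replicate (a k) k) [0..<Suc e])"
      have set_is: "set is \<subseteq> {0..e}" by (auto simp: is_def)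
      have count: "count_list is k = a k" if "k \<le> e" for k
        unfolding is_def by (subst count_list_concat_replicate) (use that in auto)
      have "list_monomial is = (\<Prod>k\<in>{0..e}. (var k :: 'k pol) ^ a k)"
        using prod_list_eq_prod_count[OF _ set_is, of "var :: nat \<Rightarrow> 'k pol"]
        by (simp add: count)
      with V i stable have "list_monomial (map (lower i) is) \<in> V" by simp
      with i show "(\<Prod>k\<in>{0..<i}. var k ^ a k) * (\<Prod>k\<in>{i..e}. var (k - 1) ^ a k) \<in> V"
        by (simp add: lowered[OF set_is] count del: map_map)
    qed
  qed
qed

lemma map_lower_in_index_lists:
  "is \<in> index_lists d \<Longrightarrow> map (lower i) is \<in> index_lists d"
  by (force simp: index_lists_def lower_def sorted_iff_nth_mono)

text \<open>For a weakly increasing argument this is a step list \<open>0\<dots>01\<dots>1\<close>.\<close>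

definition indicator_list :: "nat \<Rightarrow> nat list \<Rightarrow> nat list" where
  "indicator_list i is = map (\<lambda>j. if i \<le> j then 1 else 0) is"

lemma indicator_list_in_index_lists:
  "is \<in> index_lists d \<Longrightarrow> indicator_list i is \<in> index_lists d"
  by (force simp: index_lists_def indicator_list_def sorted_iff_nth_mono)

lemma lower_add_indicator:
  assumes "i \<ge> 1"
  shows "map2 (+) (map (lower i) is) (indicator_list i is) = is"
  using assms by (intro nth_equalityI) (auto simp: lower_def indicator_list_def)

text \<open>Let \<open>p\<close> be the position where the step of \<open>indicator_list 1 us\<close> begins. After the addition, entries
  at positions from \<open>p\<close> on are at least \<open>is ! p + 1\<close>, while the entries before \<open>p\<close> are unchanged
  and at most \<open>is ! p\<close>. The threshold \<open>is ! p + 1\<close> therefore selects exactly the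
  raised entries. Nonzero entries in \<open>us\<close> ensure that the position \<open>p\<close> exists.\<close>

lemma ex_lower_add_indicator:
  assumes "is \<in> index_lists d" "us \<in> index_lists d" "\<exists>u\<in>set us. u \<noteq> 0"
  shows "\<exists>i\<ge>1. map (lower i) (map2 (+) is (indicator_list 1 us)) = is"
proof -
  have len [simp]: "length is = d" "length us = d"
    using assms(1,2) by (simp_all add: index_lists_def)
  have ex: "\<exists>p. p < d \<and> us ! p \<ge> 1"
    using assms(3) by (auto simp: in_set_conv_nth Suc_le_eq)
  define p where "p = (LEAST p. p < d \<and> us ! p \<ge> 1)"
  have p: "p < d" "us ! p \<ge> 1"
    using LeastI_ex[OF ex] by (simp_all add: p_def)
  have below: "us ! q = 0" if "q < p" for q
    using not_less_Least[of q "\<lambda>p. p < d \<and> us ! p \<ge> 1"] that p(1) by (auto simp: p_def)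
  have above: "us ! q \<ge> 1" if "p \<le> q" "q < d" for q
    using assms(2) that p(2) sorted_nth_mono[of us p q] by (auto simp: index_lists_def)
  have mono: "is ! q \<le> is ! q'" if "q \<le> q'" "q' < d" for q q'
    using assms(1) that sorted_nth_mono[of "is" q q'] by (auto simp: index_lists_def)
  have "map (lower (is ! p + 1)) (map2 (+) is (indicator_list 1 us)) = is"
  proof (rule nth_equalityI)
    fix q assume "q < length (map (lower (is ! p + 1)) (map2 (+) is (indicator_list 1 us)))"
    then have "q < d" by simp
    then show "map (lower (is ! p + 1)) (map2 (+) is (indicator_list 1 us)) ! q = is ! q"
      using below[of q] above[of q] mono[of p q] mono[of q p] p(1)
      by (cases "q < p") (auto simp: lower_def indicator_list_def)
  qed (simp add: indicator_list_def)
  then show ?thesis by (intro exI[of _ "is ! p + 1"]) simp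
qed

text \<open>From left to right, \<open>us\<close> is peeled off by induction on its sum: it is the step list
  \<open>indicator_list 1 us\<close> plus the smaller list \<open>map (lower 1) us\<close>, and the step is undone by
  lowering. From right to left, the lowered list is a summand of the original one.\<close>

lemma lower_closed_iff_summand_closed:
  assumes "L \<subseteq> index_lists d"
  shows "(\<forall>is\<in>L. \<forall>i\<ge>1. map (lower i) is \<in> L) \<longleftrightarrow>
     (\<forall>is\<in>index_lists d. \<forall>us\<in>index_lists d. map2 (+) is us \<in> L \<longrightarrow> is \<in> L)"
proof (intro iffI ballI allI impI)
  fix "is" us
  assume lower: "\<forall>is\<in>L. \<forall>i\<ge>1. map (lower i) is \<in> L"
    and "is": "is \<in> index_lists d"
  assume "us \<in> index_lists d" "map2 (+) is us \<in> L"
  then show "is \<in> L"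
  proof (induction "sum_list us" arbitrary: us rule: less_induct)
    case less
    show ?case
    proof (cases "\<exists>u\<in>set us. u \<noteq> 0")
      case False
      then have "map2 (+) is us = is"
        using less.prems(1) "is" by (intro nth_equalityI) (auto simp: index_lists_def)
      with less.prems(2) show ?thesis by simp
    next
      case True
      let ?us' = "map (lower 1) us"
      have "map2 (+) (map2 (+) is ?us') (indicator_list 1 us) = map2 (+) is us"
        by (simp only: map2_add_assoc lower_add_indicator[OF order_refl])
      moreover have "map2 (+) is ?us' \<in> index_lists d"
        using "is" less.prems(1) by (intro map2_add_in_index_lists map_lower_in_index_lists)
      ultimately have "map2 (+) is ?us' \<in> L"
        using ex_lower_add_indicator[of "map2 (+) is ?us'" d us] True less.prems lower by metis
      moreover have "sum_list ?us' < sum_list us"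
      proof -
        from True obtain p where "p < length us" "us ! p \<noteq> 0" by (auto simp: in_set_conv_nth)
        then have "(\<Sum>q<length us. lower 1 (us ! q)) < (\<Sum>q<length us. us ! q)"
          by (intro sum_strict_mono_ex1) (auto simp: lower_def intro!: bexI[of _ p])
        then show ?thesis by (simp add: sum_list_sum_nth atLeast0LessThan)
      qed
      ultimately show ?thesis
        using less.hyps less.prems(1) map_lower_in_index_lists by blast
    qed
  qed
next
  fix "is" i
  assume summand: "\<forall>is\<in>index_lists d. \<forall>us\<in>index_lists d. map2 (+) is us \<in> L \<longrightarrow> is \<in> L"
    and "is": "is \<in> L" and i: "(1::nat) \<le> i"
  have "is": "is \<in> index_lists d" "map2 (+) (map (lower i) is) (indicator_list i is) \<in> L"
    using assms "is" lower_add_indicator[OF i] by auto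
  then show "map (lower i) is \<in> L"
    using summand map_lower_in_index_lists indicator_list_in_index_lists by blast
qed


section \<open>The equivalence\<close>

lemma compl_space_eq_span:
  "compl_space d V = pol_space.span
     (list_monomial ` {is \<in> index_lists d. list_monomial is \<notin> (V :: 'k::field pol set)})"
  unfolding compl_space_def monomials_hom_part
  by (rule arg_cong[where f = pol_space.span]) auto

lemma list_monomial_in_compl_space_iff:
  assumes "is \<in> index_lists d"
  shows "list_monomial is \<in> compl_space d V \<longleftrightarrow> list_monomial is \<notin> (V :: 'k::field pol set)"
proof -
  have *: "(list_monomial is :: 'k pol) \<in> monomials \<inter> hom_part d"
    using assms by (simp only: monomials_hom_part) blast
  then show ?thesis
    using monomial_in_spanD[of "monomials \<inter> hom_part d - V" "list_monomial is"]
    by (auto simp: compl_space_def intro: pol_space.span_base)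
qed

text \<open>By bilinearity the ideal property is decided on monomials; what is stated is its
  contrapositive there, in terms of \<open>V\<close> instead of its complement.\<close>

lemma ideal_compl_space_iff:
  fixes V :: "'k::field pol set"
  shows "ideal (compl_space d V) (M_alg d) \<longleftrightarrow>
     (\<forall>is\<in>index_lists d. \<forall>us\<in>index_lists d.
        list_monomial (map2 (+) is us) \<in> V \<longrightarrow> list_monomial is \<in> V)"
proof -
  have star: "star (list_monomial is) (list_monomial us) =
      (list_monomial (map2 (+) is us) :: 'k pol)"
    if "is \<in> index_lists d" "us \<in> index_lists d" for "is" us
    using that by (simp add: index_lists_def star_list_monomial)
  have hom: "(list_monomial us :: 'k pol) \<in> hom_part d" if "us \<in> index_lists d" for us
    using that by (simp add: index_lists_def list_monomial_in_hom_part)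
  have "compl_space d V \<subseteq> hom_part d"
    unfolding compl_space_def by (rule pol_space.span_minimal[OF _ subspace_hom_part]) auto
  then have "ideal (compl_space d V) (M_alg d) \<longleftrightarrow>
      (\<forall>p\<in>compl_space d V. \<forall>q\<in>hom_part d. star p q \<in> compl_space d V)"
    by (intro ideal_M_alg_iff) (simp_all add: compl_space_def)
  also have "\<dots> \<longleftrightarrow> (\<forall>is\<in>index_lists d. \<forall>us\<in>index_lists d.
      list_monomial (map2 (+) is us) \<in> V \<longrightarrow> list_monomial is \<in> V)" (is "?L \<longleftrightarrow> ?R")
  proof
    assume L: ?L
    show ?R
    proof (intro ballI impI, rule ccontr)
      fix "is" us
      assume "is": "is \<in> index_lists d" and us: "us \<in> index_lists d"
        and V: "list_monomial (map2 (+) is us) \<in> V" "list_monomial is \<notin> V"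
      have "list_monomial (map2 (+) is us) \<in> compl_space d V"
        using L hom[OF us] list_monomial_in_compl_space_iff[OF "is", of V] V(2)
        by (metis star[OF "is" us])
      with V(1) show False
        using list_monomial_in_compl_space_iff[OF map2_add_in_index_lists[OF "is" us], of V]
        by blast
    qed
  next
    assume R: ?R
    show ?L
    proof (intro ballI)
      fix p q :: "'k pol" assume "p \<in> compl_space d V" "q \<in> hom_part d"
      then show "star p q \<in> compl_space d V"
        unfolding compl_space_eq_span span_hom_part[symmetric]
        by (rule star_in_span) (use R map2_add_in_index_lists in \<open>auto simp: star simp del: map_map\<close>)
    qed
  qed
  finally show ?thesis .
qed

theorem lemma2p5:
  fixes V :: "'k::field pol set" and d :: nat
  assumes "d \<ge> 1"
    and "monomial_space V"
    and "V \<subseteq> hom_part d"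
  shows "block_stable V \<longleftrightarrow> ideal (compl_space d V) (M_alg d)"
proof -
  define L where "L = {is \<in> index_lists d. list_monomial is \<in> V}"
  have "block_stable V \<longleftrightarrow> (\<forall>is\<in>L. \<forall>i\<ge>1. map (lower i) is \<in> L)"
    unfolding block_stable_iff_lower
  proof (intro iffI allI impI ballI)
    fix "is" i
    assume "\<forall>is i. 1 \<le> i \<longrightarrow> list_monomial is \<in> V \<longrightarrow> list_monomial (map (lower i) is) \<in> V"
      and "is \<in> L" "(1::nat) \<le> i"
    then show "map (lower i) is \<in> L" by (auto simp: L_def map_lower_in_index_lists simp del: map_map)
  next
    fix "is" and i :: nat
    assume L: "\<forall>is\<in>L. \<forall>i\<ge>1. map (lower i) is \<in> L" and i: "1 \<le> i"
      and V: "list_monomial is \<in> V"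
    \<comment> \<open>The order of the factors does not matter, so an unsorted list is sorted before \<open>L\<close> is consulted.\<close>
    have "sort is \<in> L"
      using V assms(3) list_monomial_in_hom_part[of "sort is" d, where 'k = 'k]
        list_monomial_cong_mset[of "is" "sort is", where 'k = 'k]
      by (auto simp: L_def index_lists_def)
    with L i have "list_monomial (map (lower i) (sort is)) \<in> V"
      by (auto simp: L_def simp del: map_map)
    moreover have "list_monomial (map (lower i) (sort is)) =
        (list_monomial (map (lower i) is) :: 'k pol)"
      by (rule list_monomial_cong_mset) simp
    ultimately show "list_monomial (map (lower i) is) \<in> V" by simp
  qed
  also have "\<dots> \<longleftrightarrow> (\<forall>is\<in>index_lists d. \<forall>us\<in>index_lists d. map2 (+) is us \<in> L \<longrightarrow> is \<in> L)"
    by (rule lower_closed_iff_summand_closed) (auto simp: L_def)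
  also have "\<dots> \<longleftrightarrow> ideal (compl_space d V) (M_alg d)"
    by (auto simp: ideal_compl_space_iff L_def map2_add_in_index_lists)
  finally show ?thesis .
qed

end
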